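(* Let $H$ be a tournament with the strong EH-property. Then $H$ admits a numbering for which the backedge graph is a forest.
   Context: All graphs and digraphs are finite, with no loops or parallel edges. A tournament is a digraph such that for every pair $u,v$ of distinct vertices exactly one of $uv,vu$ is an edge; an edge $uv$ is directed from $u$ to $v$. A tournament $G$ contains a tournament $H$ if some subtournament of $G$ is isomorphic to $H$; otherwise $G$ is $H$-free. $|G|$ denotes the number of vertices. A pure pair in a tournament $G$ is an ordered pair $(A,B)$ of disjoint subsets of $V(G)$ such that every vertex in $B$ is adjacent from every vertex in $A$ (i.e. $ab\in E(G)$ for all $a\in A,b\in B$); its order is $\min(|A|,|B|)$. A tournament $H$ has the strong EH-property if there exists $c>0$ such that for every $H$-free tournament $G$ with $|G|>1$, there is a pure pair in $G$ of order at least $c|G|$. A numbering of $H$ is an enumeration $(v_1,\dots,v_n)$ of $V(H)$. The corresponding backedge graph is the (undirected, ordered) graph $B$ with vertex set $V(H)$ in which, for $1\le i<j\le n$, $v_i,v_j$ are adjacent in $B$ if and only if $v_jv_i\in E(H)$ (that is, $v_i$ is adjacent from $v_j$ in $H$). *)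

theory Defs
  imports "Graph_Theory.Graph_Theory" Complex_Main
begin

locale tournament = pair_digraph +
  assumes exactly_one_arc:
    "\<lbrakk>u \<in> pverts G; v \<in> pverts G; u \<noteq> v\<rbrakk> \<Longrightarrow> ((u, v) \<in> parcs G) \<noteq> ((v, u) \<in> parcs G)"

definition contains_tournament :: "'a pair_pre_digraph \<Rightarrow> 'b pair_pre_digraph \<Rightarrow> bool" where
  "contains_tournament G H \<longleftrightarrow>
     (\<exists>K :: 'a pair_pre_digraph. tournament K \<and> subgraph (with_proj K) (with_proj G) \<and>
        digraph_iso (with_proj H) (with_proj K))"

definition tournament_free :: "'b pair_pre_digraph \<Rightarrow> 'a pair_pre_digraph \<Rightarrow> bool" where
  "tournament_free H G \<longleftrightarrow> \<not> contains_tournament G H"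

definition pure_pair :: "'a pair_pre_digraph \<Rightarrow> 'a set \<Rightarrow> 'a set \<Rightarrow> bool" where
  "pure_pair G A B \<longleftrightarrow>
     A \<subseteq> pverts G \<and> B \<subseteq> pverts G \<and> A \<inter> B = {} \<and> (\<forall>a\<in>A. \<forall>b\<in>B. (a, b) \<in> parcs G)"

definition pair_order :: "'a set \<Rightarrow> 'a set \<Rightarrow> nat" where
  "pair_order A B = min (card A) (card B)"

text \<open>
  The host tournaments \<open>G\<close> have their vertices in \<^typ>\<open>nat\<close>. All notions involved are invariant under
  isomorphism and every finite tournament is isomorphic to one of these, so this is the
  quantification over all finite tournaments, whatever the vertex type of \<open>H\<close> (which may be finite).
\<close>
definition strong_EH_property :: "'a pair_pre_digraph \<Rightarrow> bool" where
  "strong_EH_property H \<longleftrightarrow>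
     (\<exists>c::real. c > 0 \<and>
       (\<forall>G :: nat pair_pre_digraph.
          tournament G \<longrightarrow> tournament_free H G \<longrightarrow> card (pverts G) > 1 \<longrightarrow>
          (\<exists>A B. pure_pair G A B \<and> real (pair_order A B) \<ge> c * real (card (pverts G)))))"

definition numbering :: "'a pair_pre_digraph \<Rightarrow> 'a list \<Rightarrow> bool" where
  "numbering H vs \<longleftrightarrow> distinct vs \<and> set vs = pverts H"

text \<open>
  Undirected graphs are symmetric digraphs, as in the locale \<^locale>\<open>pair_graph\<close>: each backward arc
  of \<open>H\<close> contributes both of its orientations. The vertex order is the list \<open>vs\<close> itself.
\<close>
definition backedge_graph :: "'a pair_pre_digraph \<Rightarrow> 'a list \<Rightarrow> 'a pair_pre_digraph" where
  "backedge_graph H vs =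
     \<lparr> pverts = pverts H,
       parcs = (\<Union>j < length vs. \<Union>i < j.
         if (vs ! j, vs ! i) \<in> parcs H then {(vs ! i, vs ! j), (vs ! j, vs ! i)} else {}) \<rparr>"

text \<open>
  The library predicate \<^const>\<open>forest\<close> forbids all directed cycles, including the 2-cycles that
  every edge of a symmetric digraph gives rise to. A cycle of an undirected graph is a
  cycle of the symmetric digraph with at least three edges.
\<close>
definition undirected_forest :: "'a pair_pre_digraph \<Rightarrow> bool" where
  "undirected_forest B \<longleftrightarrow>
     \<not> (\<exists>p. pre_digraph.cycle (with_proj B) p \<and> length p \<ge> 3)"

lemma backedge_graph_pair_graph:
  assumes "tournament H" "numbering H vs"
  shows "pair_graph (backedge_graph H vs)"
proof -
  interpret H: tournament H by fact
  have sub: "parcs (backedge_graph H vs) \<subseteq> parcs H \<union> (parcs H)\<inverse>"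
    by (auto simp: backedge_graph_def split: if_splits)
  show ?thesis
  proof
    show "finite (parcs (backedge_graph H vs))"
      by (rule finite_subset[OF sub]) (simp add: H.pair_finite_arcs)
    show "symmetric (with_proj (backedge_graph H vs))"
      by (fastforce simp: symmetric_def sym_def backedge_graph_def split: if_splits)
  qed (use sub H.pair_finite_verts H.pair_no_loops H.arc_fst_in_verts H.arc_snd_in_verts in
       \<open>force simp: backedge_graph_def split: if_splits\<close>)+
qed

end

theory Submission
  imports Defs
begin

text \<open>
  Fix an order on \<open>n\<close> vertices and let the backedges of a host tournament form a graph \<open>E\<close> that has
  no short cycles, but an edge between any two disjoint sets of linear size. Such a graph is obtained
  from a random graph with edge probability \<open>d / n\<close> by deleting a vertex of each of its (boundedly
  many) short cycles. A large pure pair \<open>(A, B)\<close> contains large subsets \<open>A'\<close>, \<open>B'\<close>, one of which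
  precedes the other: if \<open>A'\<close> comes first then \<open>E\<close> has no edge between them, and otherwise it has all
  of them and hence a 4-cycle. So the host has no large pure pair, must contain \<open>H\<close>, and the induced
  numbering of \<open>H\<close> has an acyclic backedge graph.
\<close>

section \<open>First moment method on the subsets of a finite set\<close>

lemma product_weight_count_bound:
  fixes p M :: real and S :: "'i \<Rightarrow> 'e set" and T :: "'j \<Rightarrow> 'e set"
  assumes P: "finite P" and I: "finite I" and J: "finite J"
    and SP: "\<And>i. i \<in> I \<Longrightarrow> S i \<subseteq> P" and TP: "\<And>j. j \<in> J \<Longrightarrow> T j \<subseteq> P"
    and p: "0 \<le> p" "p \<le> 1"
  shows "\<exists>E\<subseteq>P. card {i \<in> I. S i \<subseteq> E} + M * card {j \<in> J. T j \<inter> E = {}}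
           \<le> (\<Sum>i\<in>I. p ^ card (S i)) + M * (\<Sum>j\<in>J. (1 - p) ^ card (T j))"
proof (rule ccontr)
  \<comment> \<open>First moment method: \<open>w E\<close> is the probability that a random subset of \<open>P\<close>, containing each element
    independently with probability \<open>p\<close>, equals \<open>E\<close>.\<close>
  define w where "w E = (\<Prod>e\<in>E. p) * (\<Prod>e\<in>P - E. 1 - p)" for E
  define c where "c E = card {i \<in> I. S i \<subseteq> E} + M * card {j \<in> J. T j \<inter> E = {}}" for E
  let ?R = "(\<Sum>i\<in>I. p ^ card (S i)) + M * (\<Sum>j\<in>J. (1 - p) ^ card (T j))"
  assume "\<not> ?thesis"
  then have less: "?R < c E" if "E \<in> Pow P" for E
    using that by (auto simp: c_def not_le)
  have w0: "0 \<le> w E" for E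
    using p by (simp add: w_def)
  \<comment> \<open>Expanding the product of \<open>p + (1 - p)\<close> over \<open>P\<close> gives
    exactly one summand \<open>w E\<close> for each subset \<open>E\<close>.\<close>
  have w1: "(\<Sum>E\<in>Pow P. w E) = 1"
    unfolding w_def prod_add[OF P, symmetric] by simp
  have contain: "(\<Sum>E\<in>Pow P. w E * (if A \<subseteq> E then 1 else 0)) = p ^ card A"
    if A: "A \<subseteq> P" for A
  proof -
    \<comment> \<open>The indicator is absorbed into the product: an element of \<open>A\<close>
      missing from \<open>E\<close> contributes a factor 0. The sum over \<open>E\<close> then
      factorises elementwise, as for \<open>w1\<close>. The dual trick below puts the zeros inside
      \<open>E\<close>.\<close>
    have "w E * (if A \<subseteq> E then 1 else 0) = (\<Prod>e\<in>E. p) * (\<Prod>e\<in>P - E. if e \<in> A then 0 else 1 - p)"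
      for E
    proof (cases "A \<subseteq> E")
      case True
      then have "(\<Prod>e\<in>P - E. if e \<in> A then 0 else 1 - p) = (\<Prod>e\<in>P - E. 1 - p)"
        by (intro prod.cong) auto
      then show ?thesis using True by (simp add: w_def)
    next
      case False
      then have "(\<Prod>e\<in>P - E. if e \<in> A then 0 else 1 - p) = 0"
        using A P by (intro prod_zero) auto
      then show ?thesis using False by simp
    qed
    then have "(\<Sum>E\<in>Pow P. w E * (if A \<subseteq> E then 1 else 0))
        = (\<Prod>e\<in>P. p + (if e \<in> A then 0 else 1 - p))"
      by (simp add: prod_add[OF P])
    also have "\<dots> = (\<Prod>e\<in>P. if e \<in> A then p else 1)"
      by (intro prod.cong) auto
    also have "\<dots> = p ^ card A"
      using A P by (simp add: prod.If_cases Int_absorb1)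
    finally show ?thesis .
  qed
  have avoid: "(\<Sum>E\<in>Pow P. w E * (if A \<inter> E = {} then 1 else 0)) = (1 - p) ^ card A"
    if A: "A \<subseteq> P" for A
  proof -
    have "w E * (if A \<inter> E = {} then 1 else 0) = (\<Prod>e\<in>E. if e \<in> A then 0 else p) * (\<Prod>e\<in>P - E. 1 - p)"
      if E: "E \<in> Pow P" for E
    proof (cases "A \<inter> E = {}")
      case True
      then have "(\<Prod>e\<in>E. if e \<in> A then 0 else p) = (\<Prod>e\<in>E. p)"
        by (intro prod.cong) auto
      then show ?thesis using True by (simp add: w_def)
    next
      case False
      moreover have "finite E"
        using E P by (auto intro: finite_subset)
      ultimately have "(\<Prod>e\<in>E. if e \<in> A then 0 else p) = 0"
        by (intro prod_zero) auto
      then show ?thesis using False by simp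
    qed
    then have "(\<Sum>E\<in>Pow P. w E * (if A \<inter> E = {} then 1 else 0))
        = (\<Prod>e\<in>P. (if e \<in> A then 0 else p) + (1 - p))"
      by (simp add: prod_add[OF P])
    also have "\<dots> = (\<Prod>e\<in>P. if e \<in> A then 1 - p else 1)"
      by (intro prod.cong) auto
    also have "\<dots> = (1 - p) ^ card A"
      using A P by (simp add: prod.If_cases Int_absorb1)
    finally show ?thesis .
  qed
  have c_eq: "c E = (\<Sum>i\<in>I. if S i \<subseteq> E then 1 else 0) + M * (\<Sum>j\<in>J. if T j \<inter> E = {} then 1 else 0)" for E
    using I J by (simp add: c_def sum.If_cases Int_def)
  have "(\<Sum>E\<in>Pow P. w E * c E) = (\<Sum>E\<in>Pow P. \<Sum>i\<in>I. w E * (if S i \<subseteq> E then 1 else 0))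
      + M * (\<Sum>E\<in>Pow P. \<Sum>j\<in>J. w E * (if T j \<inter> E = {} then 1 else 0))"
    unfolding c_eq
    by (simp add: distrib_left sum.distrib sum_distrib_left mult.left_commute)
  also have "\<dots> = (\<Sum>i\<in>I. \<Sum>E\<in>Pow P. w E * (if S i \<subseteq> E then 1 else 0))
      + M * (\<Sum>j\<in>J. \<Sum>E\<in>Pow P. w E * (if T j \<inter> E = {} then 1 else 0))"
    by (intro arg_cong2[of _ _ _ _ "(+)"] arg_cong[of _ _ "(*) M"] sum.swap)
  also have "\<dots> = ?R"
    by (intro arg_cong2[of _ _ _ _ "(+)"] arg_cong[of _ _ "(*) M"] sum.cong refl contain avoid SP TP)
  finally have tot: "(\<Sum>E\<in>Pow P. w E * c E) = ?R" .
  \<comment> \<open>Deviations from the mean \<open>?R\<close> have weighted sum 0. As every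
    \<open>c E\<close> is assumed to exceed \<open>?R\<close>, all weights would have to vanish,
    although they sum to 1.\<close>
  have "0 = (\<Sum>E\<in>Pow P. w E * (c E - ?R))"
    using tot w1 by (simp add: right_diff_distrib sum_subtractf sum_distrib_right[symmetric])
  moreover have "0 \<le> w E * (c E - ?R)" if "E \<in> Pow P" for E
    using w0 less[OF that] by simp
  ultimately have "\<forall>E\<in>Pow P. w E * (c E - ?R) = 0"
    using sum_nonneg_eq_0_iff[of "Pow P" "\<lambda>E. w E * (c E - ?R)"] P by simp
  then have "w E = 0" if "E \<in> Pow P" for E
    using less[OF that] that by auto
  then show False
    using w1 by simp
qed

section \<open>Cycles as vertex lists and their expected number\<close>

definition cycle_edges :: "'a list \<Rightarrow> 'a set set" where
  "cycle_edges xs = (\<lambda>i. {xs ! i, xs ! (Suc i mod length xs)}) ` {..<length xs}"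

text \<open>Two different indices could give the same pair only if each were the cyclic successor of
  the other, which is impossible from length 3 on.\<close>

lemma card_cycle_edges:
  assumes "distinct xs" "3 \<le> length xs"
  shows "card (cycle_edges xs) = length xs"
proof -
  have "inj_on (\<lambda>i. {xs ! i, xs ! (Suc i mod length xs)}) {..<length xs}"
  proof (rule inj_onI, simp only: lessThan_iff)
    fix i j
    assume ij: "i < length xs" "j < length xs"
      and "{xs ! i, xs ! (Suc i mod length xs)} = {xs ! j, xs ! (Suc j mod length xs)}"
    moreover have "Suc i mod length xs < length xs" "Suc j mod length xs < length xs"
      using assms(2) by (auto intro!: mod_less_divisor)
    ultimately have "i = j \<or> (i = Suc j mod length xs \<and> Suc i mod length xs = j)"
      using nth_eq_iff_index_eq[OF assms(1)] by (auto simp: doubleton_eq_iff)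
    then show "i = j"
      using ij assms(2) by (auto simp: mod_Suc split: if_splits)
  qed
  then show ?thesis
    by (simp add: cycle_edges_def card_image)
qed

lemma cycle_edges_doubletons:
  assumes "distinct xs" "3 \<le> length xs" "set xs \<subseteq> V"
  shows "cycle_edges xs \<subseteq> {e. e \<subseteq> V \<and> card e = 2}"
proof
  fix e assume "e \<in> cycle_edges xs"
  then obtain i where i: "i < length xs" and e: "e = {xs ! i, xs ! (Suc i mod length xs)}"
    by (auto simp: cycle_edges_def)
  have m: "Suc i mod length xs < length xs"
    using assms(2) by (auto intro!: mod_less_divisor)
  have "Suc i mod length xs \<noteq> i"
    using i assms(2) by (auto simp: mod_Suc)
  then have "xs ! i \<noteq> xs ! (Suc i mod length xs)"
    using nth_eq_iff_index_eq[OF assms(1) i m] by simp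
  then show "e \<in> {e. e \<subseteq> V \<and> card e = 2}"
    using i m assms(3) by (auto simp: e)
qed

lemma card_cross_pairs:
  assumes "X \<inter> Y = {}"
  shows "card ((\<lambda>(x, y). {x, y}) ` (X \<times> Y)) = card X * card Y"
proof -
  have "inj_on (\<lambda>(x, y). {x, y}) (X \<times> Y)"
    using assms by (auto simp: inj_on_def doubleton_eq_iff)
  then show ?thesis
    by (simp add: card_image card_cartesian_product)
qed

text \<open>Potential cycles: each one occurs once for every starting point and direction. This
  overcounting is harmless, as their number is only bounded from above.\<close>

definition short_cycles :: "'a set \<Rightarrow> nat \<Rightarrow> 'a list set" where
  "short_cycles V g = {xs. set xs \<subseteq> V \<and> distinct xs \<and> 3 \<le> length xs \<and> length xs \<le> g}"

lemma finite_short_cycles: "finite V \<Longrightarrow> finite (short_cycles V g)"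
  by (rule finite_subset[OF _ finite_lists_length_le[of V g]]) (auto simp: short_cycles_def)

text \<open>The left side is the expected number of short cycles in a random graph with edge
  probability \<open>p\<close>. Dropping distinctness leaves \<open>card V ^ l\<close> lists of
  length \<open>l\<close>, so the bound depends only on \<open>g\<close> and the product
  \<open>card V * p\<close>.\<close>

lemma sum_short_cycles_le:
  fixes p :: real
  assumes V: "finite V" and p: "0 \<le> p"
  shows "(\<Sum>xs\<in>short_cycles V g. p ^ card (cycle_edges xs)) \<le> (\<Sum>l\<le>g. (real (card V) * p) ^ l)"
proof -
  let ?L = "\<lambda>l. {xs. set xs \<subseteq> V \<and> length xs = l}"
  have fin: "finite (?L l)" for l
    using V by (rule finite_lists_length_eq)
  have "(\<Sum>xs\<in>short_cycles V g. p ^ card (cycle_edges xs)) = (\<Sum>xs\<in>short_cycles V g. p ^ length xs)"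
    by (intro sum.cong) (auto simp: short_cycles_def card_cycle_edges)
  also have "\<dots> \<le> (\<Sum>xs\<in>(\<Union>l\<le>g. ?L l). p ^ length xs)"
    using fin p by (intro sum_mono2) (auto simp: short_cycles_def)
  also have "\<dots> = (\<Sum>l\<le>g. \<Sum>xs\<in>?L l. p ^ length xs)"
    using fin by (intro sum.UNION_disjoint) auto
  also have "\<dots> = (\<Sum>l\<le>g. \<Sum>xs\<in>?L l. p ^ l)"
    by (intro sum.cong refl) auto
  also have "\<dots> = (\<Sum>l\<le>g. (real (card V) * p) ^ l)"
    by (simp add: card_lists_length_eq[OF V] power_mult_distrib)
  finally show ?thesis .
qed

section \<open>Sparse graphs with large girth and no large anticomplete pair\<close>

lemma sparse_graph_exists:
  fixes q g :: nat
  assumes q: "0 < q"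
  shows "\<exists>k\<ge>2. \<exists>(E :: nat set set) V. V \<subseteq> {..<q * k} \<and> q * k \<le> 2 * card V \<and> 1 < card V \<and>
    (\<forall>xs\<in>short_cycles V g. \<not> cycle_edges xs \<subseteq> E) \<and>
    (\<forall>X Y. X \<subseteq> V \<longrightarrow> Y \<subseteq> V \<longrightarrow> X \<inter> Y = {} \<longrightarrow> card X = k \<longrightarrow> card Y = k \<longrightarrow>
       (\<exists>x\<in>X. \<exists>y\<in>Y. {x, y} \<in> E))"
proof -
  \<comment> \<open>There are at most \<open>4 ^ n\<close> pairs \<open>(X, Y)\<close>, and each is anticomplete with probability at most
    \<open>(1 - p) ^ (k * k) \<le> exp (- 3 * n) \<le> 8 ^ (- n)\<close> by the choice of \<open>d\<close>. \<open>C\<close> bounds the expected number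
    of short cycles and does not depend on \<open>n\<close>.\<close>
  define d where "d = 3 * q\<^sup>2"
  define C where "C = (\<Sum>l\<le>g. d ^ l)"
  \<comment> \<open>The summand \<open>d\<close> gives \<open>p \<le> 1\<close>. The rest makes
    \<open>n\<close> so large that deleting \<open>C\<close> vertices leaves more than one vertex
    and at least half of them, and that \<open>C + 1 < 2 ^ n\<close>.\<close>
  define k where "k = 2 * C + d + 4"
  define n where "n = q * k"
  define p where "p = real d / n"
  define P where "P = {e. e \<subseteq> {..<n} \<and> card e = 2}"
  define J where "J = {(X, Y). X \<subseteq> {..<n} \<and> Y \<subseteq> {..<n} \<and> X \<inter> Y = {} \<and> card X = k \<and> card Y = k}"
  define T where "T = (\<lambda>(X, Y). (\<lambda>(x::nat, y). {x, y}) ` (X \<times> Y))"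
  let ?I = "short_cycles {..<n} g"
  have kn: "k \<le> n"
    using q by (simp add: n_def)
  then have n: "0 < n" "d \<le> n" "2 * C + 4 \<le> n"
    by (auto simp: k_def)
  have p: "0 \<le> p" "p \<le> 1"
    using n by (auto simp: p_def)
  have np: "n * p = d"
    using n by (simp add: p_def)
  have finJ: "finite J" and cardJ: "card J \<le> 4 ^ n"
  proof -
    have sub: "J \<subseteq> Pow {..<n} \<times> Pow {..<n}"
      by (auto simp: J_def)
    then show "finite J"
      by (rule finite_subset) auto
    have "card J \<le> card (Pow {..<n} \<times> Pow {..<n})"
      using sub by (intro card_mono) auto
    also have "\<dots> = (2 * 2) ^ n"
      by (simp only: card_cartesian_product card_Pow finite_lessThan card_lessThan power_mult_distrib)
    finally show "card J \<le> 4 ^ n"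
      by simp
  qed
  have finP: "finite P"
    by (rule finite_subset[of _ "Pow {..<n}"]) (auto simp: P_def)
  \<comment> \<open>Both kinds of bad event are counted in one expectation, so that a single
    \<open>E\<close> handles both. An anticomplete pair weighs \<open>C + 1\<close>: a total below
    \<open>C + 1\<close> then excludes such pairs altogether and leaves at most \<open>C\<close>
    short cycles.\<close>
  have "\<exists>E\<subseteq>P. card {xs \<in> ?I. cycle_edges xs \<subseteq> E} + real (C + 1) * card {j \<in> J. T j \<inter> E = {}}
      \<le> (\<Sum>xs\<in>?I. p ^ card (cycle_edges xs)) + real (C + 1) * (\<Sum>j\<in>J. (1 - p) ^ card (T j))"
  proof (rule product_weight_count_bound[OF finP _ finJ _ _ p])
    show "finite ?I"
      by (simp add: finite_short_cycles)
    show "cycle_edges xs \<subseteq> P" if "xs \<in> ?I" for xs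
      using that cycle_edges_doubletons[of xs "{..<n}"] by (simp add: short_cycles_def P_def)
    show "T j \<subseteq> P" if "j \<in> J" for j
    proof
      fix e assume "e \<in> T j"
      then obtain x y where "e = {x, y}" "x \<in> fst j" "y \<in> snd j"
        by (auto simp: T_def split: prod.splits)
      moreover from this have "x \<noteq> y" "x < n" "y < n"
        using that by (auto simp: J_def)
      ultimately show "e \<in> P"
        by (simp add: P_def)
    qed
  qed
  then obtain E where E: "card {xs \<in> ?I. cycle_edges xs \<subseteq> E} + real (C + 1) * card {j \<in> J. T j \<inter> E = {}}
      \<le> (\<Sum>xs\<in>?I. p ^ card (cycle_edges xs)) + real (C + 1) * (\<Sum>j\<in>J. (1 - p) ^ card (T j))"
    by blast
  have "(\<Sum>xs\<in>?I. p ^ card (cycle_edges xs)) \<le> (\<Sum>l\<le>g. (real (card {..<n}) * p) ^ l)"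
    using p by (intro sum_short_cycles_le) auto
  also have "\<dots> = real C"
    by (simp add: np C_def)
  finally have cyc: "(\<Sum>xs\<in>?I. p ^ card (cycle_edges xs)) \<le> real C" .
  have anti: "(\<Sum>j\<in>J. (1 - p) ^ card (T j)) \<le> (1 / 2) ^ n"
  proof -
    have pkk: "p * (k * k) = 3 * n"
      using n(1) by (simp add: p_def d_def n_def power2_eq_square field_simps)
    have "(1 - p) ^ (k * k) \<le> exp (- p) ^ (k * k)"
      using p exp_ge_add_one_self[of "- p"] by (intro power_mono) auto
    also have "\<dots> = exp (- (p * (k * k)))"
      by (simp add: exp_of_nat_mult[symmetric] algebra_simps)
    also have "\<dots> = (1 / exp 1) ^ (3 * n)"
      unfolding pkk by (simp add: exp_minus exp_of_nat_mult[symmetric] power_divide inverse_eq_divide)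
    also have "\<dots> \<le> (1 / 2) ^ (3 * n)"
      using exp_ge_add_one_self[of 1] by (intro power_mono divide_left_mono) auto
    also have "\<dots> = (1 / 8) ^ n"
      by (simp add: power_mult power3_eq_cube)
    finally have *: "(1 - p) ^ (k * k) \<le> (1 / 8) ^ n" .
    have "(\<Sum>j\<in>J. (1 - p) ^ card (T j)) = (\<Sum>j\<in>J. (1 - p) ^ (k * k))"
      by (intro sum.cong) (auto simp: J_def T_def card_cross_pairs)
    also have "\<dots> \<le> 4 ^ n * (1 / 8) ^ n"
      unfolding sum_constant
    proof (rule mult_mono[OF _ *])
      show "real (card J) \<le> 4 ^ n"
        using cardJ by (metis of_nat_le_iff of_nat_numeral of_nat_power)
    qed (use p in auto)
    also have "\<dots> = (1 / 2) ^ n"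
      by (simp flip: power_mult_distrib)
    finally show ?thesis .
  qed
  \<comment> \<open>Even with this weight the pairs contribute less than 1 to the expectation, which
    therefore stays below \<open>C + 1\<close>.\<close>
  have Cn: "real (C + 1) * (1 / 2) ^ n < 1"
  proof -
    have "C + 1 < 2 ^ n"
      using n less_exp[of n] by linarith
    then have "real (C + 1) < 2 ^ n"
      by (metis of_nat_less_iff of_nat_numeral of_nat_power)
    then show ?thesis
      by (simp add: power_divide field_simps)
  qed
  have "real (C + 1) * (\<Sum>j\<in>J. (1 - p) ^ card (T j)) \<le> real (C + 1) * (1 / 2) ^ n"
    using anti by (intro mult_left_mono) auto
  then have lt: "card {xs \<in> ?I. cycle_edges xs \<subseteq> E} + real (C + 1) * card {j \<in> J. T j \<inter> E = {}} < C + 1"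
    using E cyc Cn by linarith
  then have "card {xs \<in> ?I. cycle_edges xs \<subseteq> E} + (C + 1) * card {j \<in> J. T j \<inter> E = {}} < C + 1"
    by (simp flip: of_nat_mult of_nat_add of_nat_Suc)
  then have few: "card {xs \<in> ?I. cycle_edges xs \<subseteq> E} \<le> C" and "card {j \<in> J. T j \<inter> E = {}} = 0"
    by (cases "card {j \<in> J. T j \<inter> E = {}}"; simp)+
  then have none: "{j \<in> J. T j \<inter> E = {}} = {}"
    using finJ by simp
  \<comment> \<open>Each remaining short cycle is destroyed at the head of its list. Lists over
    \<open>V\<close> are also lists over \<open>{..<n}\<close>, so any such cycle inside
    \<open>V\<close> would have had its head deleted.\<close>
  define D where "D = hd ` {xs \<in> ?I. cycle_edges xs \<subseteq> E}"
  define V where "V = {..<n} - D"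
  have "card D \<le> C"
    using few card_image_le[of "{xs \<in> ?I. cycle_edges xs \<subseteq> E}" hd] by (auto simp: D_def finite_short_cycles)
  moreover have "finite D"
    by (simp add: D_def finite_short_cycles)
  ultimately have "n \<le> card V + C"
    using diff_card_le_card_Diff[of D "{..<n}"] by (simp add: V_def)
  then have "n \<le> 2 * card V" "1 < card V"
    using n by auto
  moreover have "\<not> cycle_edges xs \<subseteq> E" if xs: "xs \<in> short_cycles V g" for xs
  proof
    assume "cycle_edges xs \<subseteq> E"
    then have "hd xs \<in> D"
      using xs by (auto simp: D_def V_def short_cycles_def)
    moreover have "hd xs \<in> V"
      using xs by (cases xs) (auto simp: short_cycles_def)
    ultimately show False
      by (simp add: V_def)
  qed
  moreover have "\<exists>x\<in>X. \<exists>y\<in>Y. {x, y} \<in> E"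
    if "X \<subseteq> V" "Y \<subseteq> V" "X \<inter> Y = {}" "card X = k" "card Y = k" for X Y
  proof -
    have "(X, Y) \<in> J"
      using that by (auto simp: J_def V_def)
    then have "T (X, Y) \<inter> E \<noteq> {}"
      using none by blast
    then show ?thesis
      by (auto simp: T_def)
  qed
  moreover have "V \<subseteq> {..<n}" "2 \<le> k"
    by (auto simp: V_def k_def)
  ultimately show ?thesis
    unfolding n_def by blast
qed

section \<open>Subsets separated by the vertex order\<close>

text \<open>The number of elements below \<open>m\<close> grows by at most one when \<open>m\<close>
  does, so the least \<open>m\<close> at which it reaches \<open>k\<close> does not
  overshoot.\<close>

lemma initial_segment_of_card:
  fixes A :: "nat set"
  assumes "finite A" "k \<le> card A"
  obtains m where "card (A \<inter> {..<m}) = k"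
proof -
  define m where "m = (LEAST m. k \<le> card (A \<inter> {..<m}))"
  obtain b where "A \<subseteq> {..<b}"
    using assms(1) finite_nat_iff_bounded by blast
  then have "k \<le> card (A \<inter> {..<b})"
    using assms(2) by (simp add: Int_absorb2)
  then have ge: "k \<le> card (A \<inter> {..<m})"
    unfolding m_def by (rule LeastI)
  have "card (A \<inter> {..<m}) \<le> k"
  proof (cases m)
    case (Suc m')
    then have "card (A \<inter> {..<m'}) < k"
      using not_less_Least[of m' "\<lambda>m. k \<le> card (A \<inter> {..<m})"] by (simp add: m_def)
    moreover have "card (A \<inter> {..<m}) \<le> card (insert m' (A \<inter> {..<m'}))"
      by (intro card_mono) (auto simp: Suc)
    ultimately show ?thesis
      using card_insert_le_m1[of k "A \<inter> {..<m'}" m'] by linarith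
  qed simp
  with ge that show thesis
    by simp
qed

text \<open>Cut at a point \<open>m\<close> with exactly \<open>k\<close> elements of
  \<open>A\<close> below it. Either \<open>B\<close> has \<open>k\<close> elements from
  \<open>m\<close> on, which follow the lower part of \<open>A\<close>, or at least \<open>k\<close>
  elements of \<open>B\<close> lie below \<open>m\<close> and precede the upper part of
  \<open>A\<close>.\<close>

lemma separated_subsets:
  fixes A B :: "nat set"
  assumes "finite A" "finite B" "2 * k \<le> card A" "2 * k \<le> card B"
  obtains A' B' where "A' \<subseteq> A" "B' \<subseteq> B" "card A' = k" "card B' = k"
    "(\<forall>a\<in>A'. \<forall>b\<in>B'. a < b) \<or> (\<forall>a\<in>A'. \<forall>b\<in>B'. b < a)"
proof -
  obtain m where m: "card (A \<inter> {..<m}) = k"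
    using initial_segment_of_card[OF assms(1), of k] assms(3) by auto
  have split: "card S = card (S \<inter> {..<m}) + card (S \<inter> {m..})" if "finite S" for S
  proof -
    have "S = S \<inter> {..<m} \<union> S \<inter> {m..}"
      by auto
    then show ?thesis
      using that card_Un_disjoint[of "S \<inter> {..<m}" "S \<inter> {m..}"] by fastforce
  qed
  show thesis
  proof (cases "k \<le> card (B \<inter> {m..})")
    case True
    then obtain B' where "B' \<subseteq> B \<inter> {m..}" "card B' = k"
      by (meson obtain_subset_with_card_n)
    with m show thesis
      by (intro that[of "A \<inter> {..<m}" B']) force+
  next
    case False
    then have "k \<le> card (B \<inter> {..<m})" "k \<le> card (A \<inter> {m..})"
      using split[OF assms(1)] split[OF assms(2)] m assms(3,4) by linarith+
    then obtain A' B' where "A' \<subseteq> A \<inter> {m..}" "card A' = k" "B' \<subseteq> B \<inter> {..<m}" "card B' = k"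
      by (meson obtain_subset_with_card_n)
    then show thesis
      by (intro that[of A' B']) force+
  qed
qed

section \<open>Host tournaments with prescribed backedges, and embeddings into them\<close>

definition backedge_tournament :: "'a::linorder set \<Rightarrow> 'a set set \<Rightarrow> 'a pair_pre_digraph" where
  "backedge_tournament V E = \<lparr> pverts = V,
     parcs = {(u, v). u \<in> V \<and> v \<in> V \<and> (u < v \<and> {u, v} \<notin> E \<or> v < u \<and> {u, v} \<in> E)} \<rparr>"

lemma tournament_backedge_tournament:
  assumes "finite V"
  shows "tournament (backedge_tournament V E)"
proof
  show "finite (parcs (backedge_tournament V E))"
    by (rule finite_subset[of _ "V \<times> V"]) (use assms in \<open>auto simp: backedge_tournament_def\<close>)
  show "((u, v) \<in> parcs (backedge_tournament V E)) \<noteq> ((v, u) \<in> parcs (backedge_tournament V E))"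
    if "u \<in> pverts (backedge_tournament V E)" "v \<in> pverts (backedge_tournament V E)" "u \<noteq> v" for u v
    using that by (auto simp: backedge_tournament_def insert_commute)
qed (use assms in \<open>auto simp: backedge_tournament_def\<close>)

lemma contains_tournamentE:
  assumes "contains_tournament G H"
  obtains f where "inj_on f (pverts H)" "f ` pverts H \<subseteq> pverts G"
    "\<And>u v. (u, v) \<in> parcs H \<Longrightarrow> (f u, f v) \<in> parcs G"
proof -
  obtain K h where sub: "subgraph (with_proj K) (with_proj G)"
    and h: "pre_digraph.digraph_isomorphism (with_proj H) h"
    and K: "with_proj K = app_iso h (with_proj H)"
    using assms by (auto simp: contains_tournament_def digraph_iso_def)
  \<comment> \<open>An isomorphism carries its own arc map and new tail and head functions. As
    \<open>K\<close> is a pair digraph, these functions must be \<open>fst\<close> and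
    \<open>snd\<close>, so the vertex map determines the arc map.\<close>
  have ends: "iso_tail h = fst" "iso_head h = snd"
    using arg_cong[OF K, of tail] arg_cong[OF K, of head] by auto
  have verts: "pverts K = iso_verts h ` pverts H" and arcs: "parcs K = iso_arcs h ` parcs H"
    using arg_cong[OF K, of verts] arg_cong[OF K, of arcs] by auto
  show thesis
  proof (rule that[of "iso_verts h"])
    show "inj_on (iso_verts h) (pverts H)"
      using pre_digraph.digraph_isomorphism_inj_on_verts[OF h] by simp
    show "iso_verts h ` pverts H \<subseteq> pverts G"
      using sub verts by (auto simp: subgraph_def)
    show "(iso_verts h u, iso_verts h v) \<in> parcs G" if uv: "(u, v) \<in> parcs H" for u v
    proof -
      have "iso_arcs h (u, v) = (iso_verts h u, iso_verts h v)"
        using pre_digraph.iso_verts_tail[OF h, of "(u, v)"] pre_digraph.iso_verts_head[OF h, of "(u, v)"] uv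
        by (simp add: ends prod_eq_iff)
      then show ?thesis
        using uv arcs sub by (force simp: subgraph_def)
    qed
  qed
qed

lemma pcas_nth_Suc: "pcas u p v \<Longrightarrow> Suc i < length p \<Longrightarrow> fst (p ! Suc i) = snd (p ! i)"
proof (induction p arbitrary: u i)
  case (Cons e p)
  then show ?case
    by (cases i; cases p) auto
qed simp

lemma pcas_ends: "pcas u p v \<Longrightarrow> p \<noteq> [] \<Longrightarrow> fst (hd p) = u \<and> snd (last p) = v"
  by (induction p arbitrary: u) auto

text \<open>Turns a cycle given as a list of arcs into a cyclic vertex list. Heads are the right
  choice because \<open>cycle\<close> demands distinctness of the vertex walk without its first
  entry, which is exactly the list of heads.\<close>

lemma cycle_heads:
  assumes "pre_digraph.cycle (with_proj B) p"
  shows "distinct (map snd p)"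
    and "i < length p \<Longrightarrow> (snd (p ! i), snd (p ! (Suc i mod length p))) \<in> parcs B"
proof -
  obtain u where u: "pcas u p u" "set p \<subseteq> parcs B" "p \<noteq> []"
    "distinct (tl (pre_digraph.awalk_verts (with_proj B) u p))"
    using assms by (auto simp: pre_digraph.cycle_def pre_digraph.awalk_def cas_with_proj_eq)
  then show "distinct (map snd p)"
    using pre_digraph.awalk_verts_conv'[of "with_proj B" u p u] by (simp add: cas_with_proj_eq)
  assume i: "i < length p"
  define j where "j = Suc i mod length p"
  have "j < length p"
    using i by (auto simp: j_def intro!: mod_less_divisor)
  have "fst (p ! j) = snd (p ! i)"
  proof (cases "Suc i < length p")
    case True
    then show ?thesis
      using pcas_nth_Suc[OF u(1)] by (simp add: j_def)
  next
    case False
    \<comment> \<open>The successor of the last index wraps around to 0, and the closed walk ends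
      where its first arc starts.\<close>
    then have "Suc i = length p"
      using i by simp
    then have "j = 0" "i = length p - 1"
      by (auto simp: j_def)
    then show ?thesis
      using pcas_ends[OF u(1,3)] u(3) by (simp add: hd_conv_nth last_conv_nth)
  qed
  moreover have "p ! j \<in> parcs B"
    using u(2) \<open>j < length p\<close> nth_mem by blast
  ultimately show "(snd (p ! i), snd (p ! (Suc i mod length p))) \<in> parcs B"
    unfolding j_def by (metis prod.collapse)
qed

text \<open>Number \<open>H\<close> by increasing images under the embedding. A backedge of
  \<open>H\<close> then becomes a descending arc of the host, hence an edge of \<open>E\<close>. By
  injectivity, a cycle of backedges would become a cycle in \<open>E\<close> with at most
  \<open>card (pverts H)\<close> vertices.\<close>

lemma forest_numbering_if_contained:
  fixes V :: "'b::linorder set"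
  assumes H: "tournament H" and cont: "contains_tournament (backedge_tournament V E) H"
    and girth: "\<And>xs. xs \<in> short_cycles V (card (pverts H)) \<Longrightarrow> \<not> cycle_edges xs \<subseteq> E"
  shows "\<exists>vs. numbering H vs \<and> undirected_forest (backedge_graph H vs)"
proof -
  interpret H: tournament H by fact
  obtain f where inj: "inj_on f (pverts H)" and fV: "f ` pverts H \<subseteq> V"
    and arc: "\<And>u v. (u, v) \<in> parcs H \<Longrightarrow> (f u, f v) \<in> parcs (backedge_tournament V E)"
    using contains_tournamentE[OF cont] by (auto simp: backedge_tournament_def)
  define ys where "ys = sorted_list_of_set (f ` pverts H)"
  define vs where "vs = map (the_inv_into (pverts H) f) ys"
  have ys: "set ys = f ` pverts H" "distinct ys" "sorted_wrt (<) ys"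
    using H.pair_finite_verts by (auto simp: ys_def strict_sorted_list_of_set)
  have inv: "inj_on (the_inv_into (pverts H) f) (f ` pverts H)"
    using inj by (rule inj_on_the_inv_into)
  have num: "numbering H vs"
    using ys inv the_inv_into_onto[OF inj] by (simp add: numbering_def vs_def distinct_map)
  have len: "length ys = length vs"
    by (simp add: vs_def)
  have fvs: "f (vs ! i) = ys ! i" if "i < length vs" for i
  proof -
    have "ys ! i \<in> f ` pverts H"
      using that ys(1) nth_mem[of i ys] by (simp add: vs_def)
    then show ?thesis
      using that f_the_inv_into_f[OF inj] by (simp add: vs_def)
  qed
  have backE: "{f a, f b} \<in> E" if e: "(a, b) \<in> parcs (backedge_graph H vs)" for a b
  proof -
    obtain i j where ij: "i < j" "j < length vs" and ji: "(vs ! j, vs ! i) \<in> parcs H"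
      and ab: "{a, b} = {vs ! i, vs ! j}"
      using e by (auto simp: backedge_graph_def split: if_splits)
    have "f (vs ! i) < f (vs ! j)"
      using ij sorted_wrt_nth_less[OF ys(3), of i j] fvs[of i] fvs[of j] by (simp add: len)
    then have "{f (vs ! j), f (vs ! i)} \<in> E"
      using arc[OF ji] by (auto simp: backedge_tournament_def)
    then show ?thesis
      using arg_cong[OF ab, of "image f"] by (simp add: insert_commute)
  qed
  interpret B: pair_graph "backedge_graph H vs"
    using H num by (rule backedge_graph_pair_graph)
  have "\<not> length p \<ge> 3" if p: "pre_digraph.cycle (with_proj (backedge_graph H vs)) p" for p
  proof
    assume len: "length p \<ge> 3"
    note cyc = cycle_heads[OF p]
    define xs where "xs = map f (map snd p)"
    have sub: "set (map snd p) \<subseteq> pverts H"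
    proof
      fix x assume "x \<in> set (map snd p)"
      then obtain i where "i < length p" "x = snd (p ! i)"
        by (auto simp: in_set_conv_nth)
      then show "x \<in> pverts H"
        using B.in_arcsD1[OF cyc(2)[of i]] by (simp add: backedge_graph_def)
    qed
    have "distinct xs"
      unfolding xs_def distinct_map[of f] using cyc(1) inj sub inj_on_subset by blast
    moreover have "length p \<le> card (pverts H)"
      using distinct_card[OF cyc(1)] card_mono[OF H.pair_finite_verts sub] by simp
    ultimately have "xs \<in> short_cycles V (card (pverts H))"
      using len sub fV by (auto simp: short_cycles_def xs_def)
    moreover have "cycle_edges xs \<subseteq> E"
    proof
      fix e assume "e \<in> cycle_edges xs"
      then obtain i where i: "i < length p" "e = {xs ! i, xs ! (Suc i mod length p)}"
        by (auto simp: cycle_edges_def xs_def)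
      moreover have "Suc i mod length p < length p"
        using i by (auto intro!: mod_less_divisor)
      ultimately show "e \<in> E"
        using backE[OF cyc(2)[OF i(1)]] by (simp add: xs_def)
    qed
    ultimately show False
      using girth by blast
  qed
  then show ?thesis
    using num by (auto simp: undirected_forest_def)
qed

section \<open>Pure pairs in the host tournaments\<close>

text \<open>Two vertices from each side, visited alternately, form a 4-cycle.\<close>

lemma complete_bipartite_short_cycle:
  assumes XY: "X \<subseteq> V" "Y \<subseteq> V" "X \<inter> Y = {}" and card: "2 \<le> card X" "2 \<le> card Y"
    and complete: "\<And>x y. x \<in> X \<Longrightarrow> y \<in> Y \<Longrightarrow> {x, y} \<in> E"
  obtains xs where "xs \<in> short_cycles V 4" "cycle_edges xs \<subseteq> E"
proof -
  have two: "\<exists>z\<in>Z. \<exists>z'\<in>Z. z \<noteq> z'" if Z: "2 \<le> card Z" for Z :: "'a set"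
  proof -
    obtain S where "S \<subseteq> Z" "card S = 2"
      using Z by (meson obtain_subset_with_card_n)
    then show ?thesis
      by (auto simp: card_2_iff)
  qed
  obtain a a' b b' where ab: "a \<in> X" "a' \<in> X" "a \<noteq> a'" "b \<in> Y" "b' \<in> Y" "b \<noteq> b'"
    using two[OF card(1)] two[OF card(2)] by blast
  let ?xs = "[a, b, a', b']"
  have "distinct ?xs"
    using ab XY(3) by auto
  then have "?xs \<in> short_cycles V 4"
    using ab XY(1,2) by (auto simp: short_cycles_def)
  moreover have "{..<length ?xs} = {0, 1, 2, 3}"
    by auto
  then have "cycle_edges ?xs = {{a, b}, {a', b}, {a', b'}, {a, b'}}"
    unfolding cycle_edges_def by (simp only:) (simp add: insert_commute)
  then have "cycle_edges ?xs \<subseteq> E"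
    using ab complete by simp
  ultimately show thesis
    by (rule that)
qed

lemma short_cycles_mono: "g \<le> g' \<Longrightarrow> short_cycles V g \<subseteq> short_cycles V g'"
  by (auto simp: short_cycles_def)

text \<open>The factor 2 is the loss in \<open>separated_subsets\<close>, and
  \<open>2 \<le> k\<close> leaves two vertices on each side, enough for a 4-cycle when all arcs
  descend.\<close>

lemma pure_pair_order_less:
  fixes V :: "nat set"
  assumes pure: "pure_pair (backedge_tournament V E) A B" and V: "finite V" and k: "2 \<le> k"
    and girth: "\<And>xs. xs \<in> short_cycles V 4 \<Longrightarrow> \<not> cycle_edges xs \<subseteq> E"
    and dense: "\<And>X Y. X \<subseteq> V \<Longrightarrow> Y \<subseteq> V \<Longrightarrow> X \<inter> Y = {} \<Longrightarrow> card X = k \<Longrightarrow> card Y = k \<Longrightarrow>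
      \<exists>x\<in>X. \<exists>y\<in>Y. {x, y} \<in> E"
  shows "pair_order A B < 2 * k"
proof (rule ccontr)
  assume "\<not> ?thesis"
  then have AB: "2 * k \<le> card A" "2 * k \<le> card B"
    by (auto simp: pair_order_def)
  have sub: "A \<subseteq> V" "B \<subseteq> V" "A \<inter> B = {}"
    and arc: "\<And>a b. a \<in> A \<Longrightarrow> b \<in> B \<Longrightarrow> a < b \<and> {a, b} \<notin> E \<or> b < a \<and> {a, b} \<in> E"
    using pure by (auto simp: pure_pair_def backedge_tournament_def)
  obtain A' B' where A'B': "A' \<subseteq> A" "B' \<subseteq> B" "card A' = k" "card B' = k"
    and sep: "(\<forall>a\<in>A'. \<forall>b\<in>B'. a < b) \<or> (\<forall>a\<in>A'. \<forall>b\<in>B'. b < a)"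
    using separated_subsets[OF _ _ AB] finite_subset[OF _ V] sub by metis
  have sub': "A' \<subseteq> V" "B' \<subseteq> V" "A' \<inter> B' = {}"
    using A'B' sub by auto
  from sep show False
  proof
    assume less: "\<forall>a\<in>A'. \<forall>b\<in>B'. a < b"
    obtain a b where ab: "a \<in> A'" "b \<in> B'" "{a, b} \<in> E"
      using dense[OF sub' A'B'(3,4)] by blast
    with less have "a < b"
      by blast
    with ab arc[of a b] A'B' show False
      by auto
  next
    assume less: "\<forall>a\<in>A'. \<forall>b\<in>B'. b < a"
    have complete: "{a, b} \<in> E" if "a \<in> A'" "b \<in> B'" for a b
    proof -
      have "b < a"
        using less that by blast
      then show ?thesis
        using arc[of a b] that A'B' by auto
    qed
    have "2 \<le> card A'" "2 \<le> card B'"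
      using k A'B' by auto
    from complete_bipartite_short_cycle[OF sub' this complete] girth show False
      by metis
  qed
qed

section \<open>Choice of the constants and conclusion\<close>

theorem mainTheorem1:
  fixes H :: "'a pair_pre_digraph"
  assumes "tournament H"
    and "strong_EH_property H"
  shows "\<exists>vs. numbering H vs \<and> undirected_forest (backedge_graph H vs)"
proof -
  obtain c :: real where c: "c > 0"
    and EH: "\<And>G :: nat pair_pre_digraph. tournament G \<Longrightarrow> tournament_free H G \<Longrightarrow>
      card (pverts G) > 1 \<Longrightarrow> \<exists>A B. pure_pair G A B \<and> real (pair_order A B) \<ge> c * real (card (pverts G))"
    using assms(2) by (auto simp: strong_EH_property_def)
  \<comment> \<open>Length 4 serves the bound on pure pairs, \<open>card (pverts H)\<close> the
    backedge cycles of an embedded copy of \<open>H\<close>.\<close>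
  define g where "g = max 4 (card (pverts H))"
  \<comment> \<open>With \<open>4 \<le> c * q\<close> and \<open>q * k \<le> 2 * card V\<close>, a
    pure pair of order at least \<open>c * card V\<close> has order at least \<open>2 * k\<close>,
    which \<open>pure_pair_order_less\<close> rules out.\<close>
  define q where "q = nat \<lceil>4 / c\<rceil>"
  have "4 / c \<le> q" "0 < 4 / c"
    using c by (auto simp: q_def of_nat_ceiling)
  then have q: "4 \<le> c * q" "0 < q"
    using c by (auto simp: field_simps intro: gr0I)
  obtain k and E :: "nat set set" and V where k: "2 \<le> k" and V: "V \<subseteq> {..<q * k}"
    and size: "q * k \<le> 2 * card V" "1 < card V"
    and girth: "\<And>xs. xs \<in> short_cycles V g \<Longrightarrow> \<not> cycle_edges xs \<subseteq> E"
    and dense: "\<And>X Y. X \<subseteq> V \<Longrightarrow> Y \<subseteq> V \<Longrightarrow> X \<inter> Y = {} \<Longrightarrow> card X = k \<Longrightarrow> card Y = k \<Longrightarrow>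
      \<exists>x\<in>X. \<exists>y\<in>Y. {x, y} \<in> E"
    using sparse_graph_exists[OF q(2), of g] by metis
  let ?G = "backedge_tournament V E"
  have V': "pverts ?G = V" and fin: "finite V"
    using V finite_subset by (auto simp: backedge_tournament_def)
  show ?thesis
  proof (cases "contains_tournament ?G H")
    case True
    moreover have "short_cycles V (card (pverts H)) \<subseteq> short_cycles V g"
      by (intro short_cycles_mono) (simp add: g_def)
    ultimately show ?thesis
      using forest_numbering_if_contained[OF assms(1)] girth by blast
  next
    case False
    then have free: "tournament_free H ?G"
      by (simp add: tournament_free_def)
    obtain A B where pure: "pure_pair ?G A B" and order: "c * card V \<le> pair_order A B"
      using EH[OF tournament_backedge_tournament[OF fin] free] size(2) unfolding V' by blast
    have "pair_order A B < 2 * k"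
    proof (rule pure_pair_order_less[OF pure fin k _ dense])
      show "\<not> cycle_edges xs \<subseteq> E" if "xs \<in> short_cycles V 4" for xs
        using that girth short_cycles_mono[of 4 g V] by (auto simp: g_def)
    qed
    moreover have "4 * k \<le> c * (2 * card V)"
    proof -
      have "4 * real k \<le> c * q * k"
        using q(1) by (intro mult_right_mono) auto
      also have "\<dots> = c * real (q * k)"
        by simp
      also have "\<dots> \<le> c * real (2 * card V)"
        using size(1) c by (intro mult_left_mono) (auto simp only: of_nat_le_iff)
      finally show ?thesis by simp
    qed
    ultimately show ?thesis
      using order by simp
  qed
qed

end
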